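(* There exist absolute constants $c>0$ and $C>0$ such that the following holds. Let $n\ge 1$, let $K\geq 1$, and let $A,B\subseteq\mathbb{F}_2^n$ be non-empty sets with $$|A+B|\leq K|A|^{1/2}|B|^{1/2}.$$ Then there exist a subspace $H\subseteq\mathbb{F}_2^n$ with $$|H|\geq c\,\exp(-C\sqrt{K})\,|A|$$ and elements $x,y\in\mathbb{F}_2^n$ such that $$|A\cap(x+H)|^{1/2}\,|B\cap(y+H)|^{1/2}\geq\frac{1}{2K}|H|.$$
   Context: $\mathbb{F}_2$ is the field with two elements and $\mathbb{F}_2^n$ the $n$-dimensional vector space over it. For $A,B\subseteq\mathbb{F}_2^n$, the sumset is $A+B=\{a+b: a\in A,\ b\in B\}$. For $x\in\mathbb{F}_2^n$ and a subspace $H$, $x+H=\{x+h:h\in H\}$. The paper writes the size bound as $|H|\gg\exp(-O(\sqrt{K}))|A|$, meaning the stated bound with absolute constants $c,C$. *)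

theory Defs
  imports
    Complex_Main
    "HOL-Library.Z2"
    "HOL-Library.Function_Algebras"
    "HOL-Library.Set_Algebras"
begin

text \<open>
  The dimension must be a term, since the constants of the theorem are uniform in it.
  A vector of the \<open>n\<close>-dimensional space over the two-element field \<^typ>\<open>bit\<close> is therefore
  a sequence extended by zero from index \<open>n\<close> on, which makes the pointwise addition of
  \<open>Function_Algebras\<close> the addition of vectors. Sumsets and translates are \<open>A + B\<close> and
  \<open>x +o H\<close> of \<open>Set_Algebras\<close>.
\<close>

definition F2_space :: "nat \<Rightarrow> (nat \<Rightarrow> bit) set" where
  "F2_space n = {v. \<forall>i\<ge>n. v i = 0}"

definition F2_scale :: "bit \<Rightarrow> (nat \<Rightarrow> bit) \<Rightarrow> (nat \<Rightarrow> bit)" where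
  "F2_scale a v = (\<lambda>i. a * v i)"

global_interpretation F2: vector_space F2_scale
  by unfold_locales
    (simp_all only: F2_scale_def fun_eq_iff plus_fun_apply distrib_left distrib_right mult.assoc
      mult_1_left simp_thms)

lemma subspace_F2_space: "F2.subspace (F2_space n)"
  by (simp add: F2.subspace_def F2_space_def F2_scale_def)

lemma card_F2_space: "card (F2_space n) = 2 ^ n"
proof -
  have "bij_betw (\<lambda>v. {i. v i = 1}) (F2_space n) (Pow {..<n})"
    by (rule bij_betw_byWitness[where f' = "\<lambda>S i. if i \<in> S then 1 else 0"])
      (auto simp: F2_space_def fun_eq_iff not_less[symmetric])
  then show ?thesis
    by (simp add: bij_betw_same_card card_Pow)
qed

lemma finite_F2_space: "finite (F2_space n)"
  by (rule card_ge_0_finite) (simp add: card_F2_space)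

end

theory Submission
  imports Defs "HOL-Analysis.Convex"
begin

text \<open>
  Let $S = |A|^{1/2} |B|^{1/2}$ and $K = |A+B|/S$. If for every character $\xi$ nontrivial on the
  current subspace $H$ the relative Fourier coefficients $\alpha$ of $A$ and $\beta$ of $B$ satisfy
  $\alpha\beta \le 1/(2K)$, then Cauchy-Schwarz and Parseval give $S \ge |H|/(2K)$. Otherwise cut
  along such a $\xi$. The halves $A_0$, $B_0$, $B_1$ (with $\alpha \ge \beta$ and $A_0$, $B_0$ the larger
  halves) have disjoint sumsets $A_0+B_0$ and $A_0+B_1$, while the two new values of $S$ add up
  to about $(1+c\alpha)S$ with $\alpha \ge (2K)^{-1/2}$. So one pair has doubling smaller by a factor
  $1-c'K^{-1/2}$; this decreases $\sqrt K$ by a constant, and $S$ drops by at most a constant factor. Hence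
  the potential $S\exp(-100\sqrt K)$ does not decrease. If $\beta$ is close to $1$ then $B_1$ may be tiny,
  and there the loss in $S$ is instead bounded by a power of the gain in $K$.
\<close>

section \<open>Characters\<close>

text \<open>This is -1 raised to the inner product of \<xi> and x over the first \<open>n\<close>
  coordinates. Frequencies are again vectors, so the dual group is \<open>F2_space n\<close>
  itself.\<close>

definition chi :: "nat \<Rightarrow> (nat \<Rightarrow> bit) \<Rightarrow> (nat \<Rightarrow> bit) \<Rightarrow> real" where
  "chi n \<xi> x = (\<Prod>i<n. if \<xi> i = 1 \<and> x i = 1 then - 1 else 1)"

text \<open>Unnormalised Fourier coefficient of the indicator of A: its value at frequency 0 is
  \<open>card A\<close>, and relative coefficients arise on dividing by
  \<open>card A\<close>.\<close>

definition hat :: "nat \<Rightarrow> (nat \<Rightarrow> bit) set \<Rightarrow> (nat \<Rightarrow> bit) \<Rightarrow> real" where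
  "hat n A \<xi> = (\<Sum>a\<in>A. chi n \<xi> a)"

lemma F2_add_self [simp]: "(x :: nat \<Rightarrow> bit) + x = 0"
  by (simp add: fun_eq_iff)

lemma F2_add_self_left [simp]: "(x :: nat \<Rightarrow> bit) + (x + y) = y"
  by (simp add: add.assoc[symmetric])

lemma F2_add_eq_0_iff: "(x :: nat \<Rightarrow> bit) + y = 0 \<longleftrightarrow> x = y"
  by (metis F2_add_self F2_add_self_left add.right_neutral)

lemma chi_commute: "chi n \<xi> x = chi n x \<xi>"
  unfolding chi_def by (intro prod.cong) auto

lemma chi_add: "chi n \<xi> (x + y) = chi n \<xi> x * chi n \<xi> y"
  unfolding chi_def prod.distrib[symmetric]
proof (intro prod.cong refl)
  fix i
  show "(if \<xi> i = 1 \<and> (x + y) i = 1 then - 1 else 1 :: real) =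
    (if \<xi> i = 1 \<and> x i = 1 then - 1 else 1) * (if \<xi> i = 1 \<and> y i = 1 then - 1 else 1)"
    by (cases "x i"; cases "y i") auto
qed

lemma chi_zero [simp]: "chi n \<xi> 0 = 1"
  by (simp add: chi_def)

lemma chi_square [simp]: "chi n \<xi> x * chi n \<xi> x = 1"
  by (simp flip: chi_add)

lemma chi_cases: "chi n \<xi> x = 1 \<or> chi n \<xi> x = - 1"
  using chi_square[of n \<xi> x] unfolding square_eq_1_iff .

lemma chi_nontrivial:
  assumes "x \<in> F2_space n" "x \<noteq> 0"
  obtains \<xi> where "\<xi> \<in> F2_space n" "chi n \<xi> x = - 1"
proof -
  obtain i where i: "x i \<noteq> 0" using assms(2) by (auto simp: fun_eq_iff)
  then have "i < n" using assms(1) by (force simp: F2_space_def not_less[symmetric])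
  define \<xi> :: "nat \<Rightarrow> bit" where "\<xi> = (\<lambda>j. if j = i then 1 else 0)"
  have "chi n \<xi> x = (\<Prod>j<n. if j = i then - 1 else 1)"
    unfolding chi_def using i by (intro prod.cong) (auto simp: \<xi>_def)
  also have "\<dots> = - 1" using \<open>i < n\<close> by simp
  finally show thesis
    using that[of \<xi>] \<open>i < n\<close> by (auto simp: F2_space_def \<xi>_def)
qed

text \<open>Translation by an element of H with character value -1 permutes H and negates the sum,
  which therefore vanishes.\<close>

lemma sum_chi_subspace:
  assumes "F2.subspace H" "finite H"
  shows "(\<Sum>h\<in>H. chi n \<xi> h) = (if \<forall>h\<in>H. chi n \<xi> h = 1 then real (card H) else 0)"
proof (cases "\<forall>h\<in>H. chi n \<xi> h = 1")
  case False
  then obtain k where k: "k \<in> H" "chi n \<xi> k = - 1" using chi_cases by blast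
  have "(\<Sum>h\<in>H. chi n \<xi> h) = (\<Sum>h\<in>H. chi n \<xi> (k + h))"
    by (rule sum.reindex_bij_witness[of _ "\<lambda>h. k + h" "\<lambda>h. k + h"])
      (auto intro: F2.subspace_add assms k)
  also have "\<dots> = - (\<Sum>h\<in>H. chi n \<xi> h)"
    by (simp add: chi_add k sum_negf)
  finally have "(\<Sum>h\<in>H. chi n \<xi> h) = 0" by simp
  with False show ?thesis by presburger
qed simp

text \<open>As \<open>chi\<close> is symmetric in its two vectors, this is a character sum over the
  whole space seen as a subspace; coordinate vectors detect every nonzero x.\<close>

lemma sum_chi_space:
  assumes "x \<in> F2_space n"
  shows "(\<Sum>\<xi>\<in>F2_space n. chi n \<xi> x) = (if x = 0 then 2 ^ n else 0)"
proof -
  have "(\<Sum>\<xi>\<in>F2_space n. chi n \<xi> x) = (\<Sum>\<xi>\<in>F2_space n. chi n x \<xi>)"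
    by (simp add: chi_commute)
  also have "\<dots> = (if \<forall>\<xi>\<in>F2_space n. chi n x \<xi> = 1 then 2 ^ n else 0)"
    by (simp add: sum_chi_subspace subspace_F2_space finite_F2_space card_F2_space)
  also have "(\<forall>\<xi>\<in>F2_space n. chi n x \<xi> = 1) \<longleftrightarrow> x = 0"
    using chi_nontrivial[OF assms] by (force simp: chi_commute[of n x])
  finally show ?thesis .
qed

section \<open>Annihilators, Parseval and additive energy\<close>

definition annihilator :: "nat \<Rightarrow> (nat \<Rightarrow> bit) set \<Rightarrow> (nat \<Rightarrow> bit) set" where
  "annihilator n H = {\<xi> \<in> F2_space n. \<forall>h\<in>H. chi n \<xi> h = 1}"

text \<open>Double counting of the sum of \<open>chi n \<xi> h\<close>: summing over h first leaves
  |H| for each annihilating frequency, summing over frequencies first leaves only h = 0.\<close>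

lemma card_annihilator:
  assumes "F2.subspace H" "H \<subseteq> F2_space n"
  shows "real (card (annihilator n H)) * real (card H) = 2 ^ n"
proof -
  have fin: "finite H" using assms(2) finite_F2_space finite_subset by blast
  have "(\<Sum>\<xi>\<in>F2_space n. \<Sum>h\<in>H. chi n \<xi> h)
      = (\<Sum>\<xi>\<in>F2_space n. if \<forall>h\<in>H. chi n \<xi> h = 1 then real (card H) else 0)"
    by (simp add: sum_chi_subspace assms fin)
  also have "\<dots> = real (card (annihilator n H)) * real (card H)"
    unfolding annihilator_def by (simp add: sum.inter_filter[symmetric] finite_F2_space)
  finally have "real (card (annihilator n H)) * real (card H)
      = (\<Sum>h\<in>H. \<Sum>\<xi>\<in>F2_space n. chi n \<xi> h)"
    by (subst sum.swap) simp
  also have "\<dots> = (\<Sum>h\<in>H. if h = 0 then 2 ^ n else 0)"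
    using assms(2) by (intro sum.cong sum_chi_space) auto
  also have "\<dots> = 2 ^ n" using F2.subspace_0[OF assms(1)] fin by simp
  finally show ?thesis .
qed

text \<open>The values at s and t multiply to the value at s + t, and orthogonality keeps only s + t
  = 0, which in characteristic 2 is the diagonal. General weights f serve both indicators and
  representation counts.\<close>

lemma parseval:
  assumes "X \<subseteq> F2_space n"
  shows "(\<Sum>\<xi>\<in>F2_space n. (\<Sum>s\<in>X. f s * chi n \<xi> s)\<^sup>2) = 2 ^ n * (\<Sum>s\<in>X. (f s)\<^sup>2)"
proof -
  have fin: "finite X" using assms finite_F2_space finite_subset by blast
  have "(\<Sum>\<xi>\<in>F2_space n. (\<Sum>s\<in>X. f s * chi n \<xi> s)\<^sup>2)
      = (\<Sum>\<xi>\<in>F2_space n. \<Sum>s\<in>X. \<Sum>t\<in>X. f s * f t * chi n \<xi> (s + t))"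
    by (simp add: power2_eq_square sum_product chi_add mult_ac)
  also have "\<dots> = (\<Sum>s\<in>X. \<Sum>\<xi>\<in>F2_space n. \<Sum>t\<in>X. f s * f t * chi n \<xi> (s + t))"
    by (rule sum.swap)
  also have "\<dots> = (\<Sum>s\<in>X. \<Sum>t\<in>X. f s * f t * (\<Sum>\<xi>\<in>F2_space n. chi n \<xi> (s + t)))"
    by (subst sum.swap[of _ X]) (simp add: sum_distrib_left)
  also have "\<dots> = (\<Sum>s\<in>X. \<Sum>t\<in>X. f s * f t * (if s = t then 2 ^ n else 0))"
  proof (intro sum.cong refl, goal_cases)
    case (1 s t)
    then have "s + t \<in> F2_space n"
      using assms F2.subspace_add[OF subspace_F2_space] by blast
    then show ?case by (simp add: sum_chi_space F2_add_eq_0_iff)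
  qed
  also have "\<dots> = 2 ^ n * (\<Sum>s\<in>X. (f s)\<^sup>2)"
    using fin by (simp add: if_distrib sum_distrib_left power2_eq_square mult_ac cong: if_cong)
  finally show ?thesis .
qed

lemma parseval_hat:
  assumes "A \<subseteq> F2_space n"
  shows "(\<Sum>\<xi>\<in>F2_space n. (hat n A \<xi>)\<^sup>2) = 2 ^ n * real (card A)"
  using parseval[OF assms, of "\<lambda>_. 1"] by (simp add: hat_def)

lemma abs_hat_le: "\<bar>hat n A \<xi>\<bar> \<le> real (card A)"
proof -
  have "\<bar>hat n A \<xi>\<bar> \<le> (\<Sum>a\<in>A. \<bar>chi n \<xi> a\<bar>)" unfolding hat_def by (rule sum_abs)
  also have "\<dots> = (\<Sum>a\<in>A. 1)"
  proof (intro sum.cong refl)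
    show "\<bar>chi n \<xi> a\<bar> = 1" for a using chi_cases[of n \<xi> a] by auto
  qed
  finally show ?thesis by simp
qed

lemma F2_sumset_subset: "A \<subseteq> F2_space n \<Longrightarrow> B \<subseteq> F2_space n \<Longrightarrow> A + B \<subseteq> F2_space n"
  using F2.subspace_add[OF subspace_F2_space] by (fastforce simp: set_plus_def)

text \<open>Cauchy-Schwarz for the number of representations as a sum, whose second moment is the
  additive energy, evaluated by Parseval.\<close>

lemma sumset_fourier:
  assumes "A \<subseteq> F2_space n" "B \<subseteq> F2_space n"
  shows "2 ^ n * (real (card A) * real (card B))\<^sup>2
    \<le> real (card (A + B)) * (\<Sum>\<xi>\<in>F2_space n. (hat n A \<xi> * hat n B \<xi>)\<^sup>2)"
proof -
  have fin: "finite A" "finite B" using assms finite_F2_space finite_subset by blast+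
  define S where "S = A + B"
  have finS: "finite S" unfolding S_def using fin by (simp add: finite_set_plus)
  have subS: "S \<subseteq> F2_space n" unfolding S_def using assms by (rule F2_sumset_subset)
  define r where "r s = (\<Sum>p\<in>{p \<in> A \<times> B. fst p + snd p = s}. 1 :: real)" for s
  \<comment> \<open>Sorting pairs by their sum. With g a character this is the convolution theorem;
    with g = 1 it gives the total mass |A||B| for Cauchy-Schwarz.\<close>
  have group: "(\<Sum>s\<in>S. r s * g s) = (\<Sum>p\<in>A \<times> B. g (fst p + snd p))" for g :: "_ \<Rightarrow> real"
  proof -
    have "(\<Sum>s\<in>S. r s * g s)
        = (\<Sum>s\<in>S. \<Sum>p\<in>{p \<in> A \<times> B. fst p + snd p = s}. g (fst p + snd p))"
      unfolding r_def sum_distrib_right by (intro sum.cong) auto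
    also have "\<dots> = (\<Sum>p\<in>A \<times> B. g (fst p + snd p))"
      using fin finS by (intro sum.group) (auto simp: S_def)
    finally show ?thesis .
  qed
  have hat: "hat n A \<xi> * hat n B \<xi> = (\<Sum>s\<in>S. r s * chi n \<xi> s)" for \<xi>
    unfolding group hat_def sum_product sum.cartesian_product
    by (simp add: chi_add case_prod_unfold)
  have "(\<Sum>\<xi>\<in>F2_space n. (hat n A \<xi> * hat n B \<xi>)\<^sup>2) = 2 ^ n * (\<Sum>s\<in>S. (r s)\<^sup>2)"
    unfolding hat by (rule parseval[OF subS])
  moreover have "(real (card A) * real (card B))\<^sup>2 \<le> (\<Sum>s\<in>S. (r s)\<^sup>2) * real (card S)"
    using sum_squared_le_sum_of_squares[of r S] group[of "\<lambda>_. 1"] fin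
    by (simp add: card_cartesian_product)
  ultimately show ?thesis
    by (simp add: S_def[symmetric] mult.commute mult.left_commute)
qed

lemma sum_abs_hat_le:
  assumes "A \<subseteq> F2_space n" "B \<subseteq> F2_space n"
  shows "(\<Sum>\<xi>\<in>F2_space n. \<bar>hat n A \<xi> * hat n B \<xi>\<bar>)
    \<le> 2 ^ n * sqrt (real (card A)) * sqrt (real (card B))"
proof -
  have "(\<Sum>\<xi>\<in>F2_space n. \<bar>hat n A \<xi>\<bar> * \<bar>hat n B \<xi>\<bar>)\<^sup>2
      \<le> (\<Sum>\<xi>\<in>F2_space n. \<bar>hat n A \<xi>\<bar>\<^sup>2) * (\<Sum>\<xi>\<in>F2_space n. \<bar>hat n B \<xi>\<bar>\<^sup>2)"
    by (rule Cauchy_Schwarz_ineq_sum)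
  also have "\<dots> = (2 ^ n * sqrt (real (card A)) * sqrt (real (card B)))\<^sup>2"
    using assms by (simp add: parseval_hat power_mult_distrib) (simp add: power2_eq_square)
  finally show ?thesis
    by (subst abs_mult) (rule power2_le_imp_le, auto)
qed

section \<open>The Fourier-flat case\<close>

text \<open>Let s be the geometric mean of |A| and |B|. In the energy sum each annihilating
  frequency contributes at most s^4, and the others together at most s^2/(2K) times 2^n s. As |A+B|
  is at most K s, the latter cover only half of the lower bound 2^n s^4, so the annihilator, of size
  2^n/|H|, must supply the other half.\<close>

lemma flat_dense:
  assumes H: "F2.subspace H" "H \<subseteq> F2_space n"
    and AB: "A \<subseteq> F2_space n" "B \<subseteq> F2_space n" "A \<noteq> {}" "B \<noteq> {}" and "K > 0"
    and small: "real (card (A + B)) \<le> K * sqrt (real (card A)) * sqrt (real (card B))"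
    and flat: "\<And>\<xi>. \<xi> \<in> F2_space n \<Longrightarrow> \<xi> \<notin> annihilator n H \<Longrightarrow>
      \<bar>hat n A \<xi> * hat n B \<xi>\<bar> \<le> real (card A) * real (card B) / (2 * K)"
  shows "1 / (2 * K) * real (card H) \<le> sqrt (real (card A)) * sqrt (real (card B))"
proof -
  have fin: "finite A" "finite B" "finite H"
    using AB H(2) finite_F2_space finite_subset by blast+
  define s where "s = sqrt (real (card A)) * sqrt (real (card B))"
  have s2: "real (card A) * real (card B) = s\<^sup>2" by (simp add: s_def power_mult_distrib)
  have s0: "s > 0" using AB fin by (simp add: s_def card_gt_0_iff)
  have H0: "real (card H) > 0" using fin F2.subspace_0[OF H(1)] by (auto simp: card_gt_0_iff)
  let ?h = "\<lambda>\<xi>. \<bar>hat n A \<xi> * hat n B \<xi>\<bar>" and ?P = "annihilator n H"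
  have PV: "?P \<subseteq> F2_space n" by (auto simp: annihilator_def)
  \<comment> \<open>The trivial bound is used on the annihilator. Elsewhere flatness bounds one
    factor of the square, and the remaining first power is summable by
    \<open>sum_abs_hat_le\<close>.\<close>
  have pw: "(hat n A \<xi> * hat n B \<xi>)\<^sup>2 \<le> (if \<xi> \<in> ?P then s ^ 4 else 0) + s\<^sup>2 / (2 * K) * ?h \<xi>"
    if "\<xi> \<in> F2_space n" for \<xi>
  proof (cases "\<xi> \<in> ?P")
    case True
    have "?h \<xi> \<le> s\<^sup>2" unfolding abs_mult s2[symmetric]
      by (intro mult_mono abs_hat_le) auto
    then have "?h \<xi> ^ 2 \<le> (s\<^sup>2)\<^sup>2" by (intro power_mono) auto
    then have "(hat n A \<xi> * hat n B \<xi>)\<^sup>2 \<le> s ^ 4" by simp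
    moreover have "0 \<le> s\<^sup>2 / (2 * K) * ?h \<xi>" using \<open>K > 0\<close> by simp
    ultimately show ?thesis using True by simp
  next
    case False
    have "?h \<xi> * ?h \<xi> \<le> s\<^sup>2 / (2 * K) * ?h \<xi>"
      using flat[OF that False] unfolding s2 by (intro mult_right_mono) auto
    then show ?thesis using False by (simp add: power2_eq_square)
  qed
  have "(\<Sum>\<xi>\<in>F2_space n. (hat n A \<xi> * hat n B \<xi>)\<^sup>2)
      \<le> (\<Sum>\<xi>\<in>F2_space n. (if \<xi> \<in> ?P then s ^ 4 else 0) + s\<^sup>2 / (2 * K) * ?h \<xi>)"
    by (intro sum_mono pw)
  also have "\<dots> = real (card ?P) * s ^ 4 + s\<^sup>2 / (2 * K) * (\<Sum>\<xi>\<in>F2_space n. ?h \<xi>)"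
    unfolding sum.distrib sum_distrib_left[symmetric]
    using PV by (simp add: sum.If_cases finite_F2_space Int_absorb1)
  also have "\<dots> \<le> real (card ?P) * s ^ 4 + s\<^sup>2 / (2 * K) * (2 ^ n * s)"
    using sum_abs_hat_le[OF AB(1,2)] \<open>K > 0\<close>
    by (intro add_left_mono mult_left_mono) (auto simp: s_def mult.assoc)
  finally have E: "(\<Sum>\<xi>\<in>F2_space n. (hat n A \<xi> * hat n B \<xi>)\<^sup>2) \<le> \<dots>" .
  have "2 ^ n * (s\<^sup>2)\<^sup>2 \<le> real (card (A + B)) * (\<Sum>\<xi>\<in>F2_space n. (hat n A \<xi> * hat n B \<xi>)\<^sup>2)"
    using sumset_fourier[OF AB(1,2)] unfolding s2 .
  also have "\<dots> \<le> (K * s) * (real (card ?P) * s ^ 4 + s\<^sup>2 / (2 * K) * (2 ^ n * s))"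
    using small E \<open>K > 0\<close> s0 by (intro mult_mono) (auto simp: s_def mult.assoc sum_nonneg)
  \<comment> \<open>The 2 in the flatness threshold makes the second term half of the left-hand
    side, so it can be absorbed.\<close>
  also have "\<dots> = K * s * real (card ?P) * s ^ 4 + 2 ^ n * s ^ 4 / 2"
    using \<open>K > 0\<close> by (simp add: field_simps power2_eq_square power4_eq_xxxx)
  finally have "(2 ^ n / 2) * s ^ 4 \<le> (K * s * real (card ?P)) * s ^ 4"
    by (simp add: algebra_simps)
  then have "2 ^ n / 2 \<le> K * s * real (card ?P)" using s0 by simp
  then have "real (card ?P) * real (card H) \<le> real (card ?P) * (2 * K * s)"
    unfolding card_annihilator[OF H] by (simp add: algebra_simps)
  moreover have "real (card ?P) > 0"
    using card_annihilator[OF H] by (metis zero_less_mult_pos2 H0 zero_less_power zero_less_numeral)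
  ultimately have "real (card H) \<le> 2 * K * s" by simp
  then show ?thesis using \<open>K > 0\<close> by (simp add: s_def[symmetric] field_simps)
qed

section \<open>Cutting by a hyperplane\<close>

text \<open>The trade behind the potential: shrinking the geometric mean by a factor w is paid for
  by a drop of d in the square root of the doubling.\<close>

lemma exp_cut:
  fixes k k' d w :: real
  assumes "k' \<le> k - d" "exp (- 100 * d) \<le> w"
  shows "exp (- 100 * k) \<le> w * exp (- 100 * k')"
proof -
  have "exp (- 100 * k) = exp (- 100 * d) * exp (- 100 * (k - d))"
    by (simp add: exp_add[symmetric] algebra_simps)
  also have "\<dots> \<le> w * exp (- 100 * k')"
    using assms by (intro mult_mono) (auto intro: order_trans[OF exp_ge_zero])
  finally show ?thesis .
qed

text \<open>The square of the mean of sqrt(1 + \<beta>) and sqrt(1 - \<beta>) is at least 1 -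
  \<beta>^2/2, hence at least 1 - \<alpha>/4 because \<beta> is at most both \<alpha> and 1/2. This
  second-order loss is outweighed by the factor 1 + \<alpha>.\<close>

lemma cut_gain:
  fixes \<alpha> \<beta> :: real
  assumes "0 \<le> \<beta>" "\<beta> \<le> \<alpha>" "\<alpha> \<le> 1" "\<beta> \<le> 1 / 2"
  shows "1 + \<alpha> / 10 \<le> sqrt ((1 + \<alpha>) * (1 + \<beta>)) / 2 + sqrt ((1 + \<alpha>) * (1 - \<beta>)) / 2"
proof -
  define p q where "p = sqrt (1 + \<beta>)" and "q = sqrt (1 - \<beta>)"
  have pq: "p\<^sup>2 = 1 + \<beta>" "q\<^sup>2 = 1 - \<beta>" "p \<ge> 0" "q \<ge> 0" using assms by (auto simp: p_def q_def)
  have b2: "\<beta>\<^sup>2 \<le> \<alpha> / 2" using mult_mono[of \<beta> \<alpha> \<beta> "1 / 2"] assms by (simp add: power2_eq_square)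
  have a2: "\<alpha>\<^sup>2 \<le> \<alpha>" using mult_left_mono[of \<alpha> 1 \<alpha>] assms by (simp add: power2_eq_square)
  have "1 - \<beta>\<^sup>2 \<le> p * q"
  proof (rule power2_le_imp_le)
    have "(p * q)\<^sup>2 = 1 - \<beta>\<^sup>2" unfolding power_mult_distrib pq by (simp add: algebra_simps power2_eq_square)
    moreover have "(1 - \<beta>\<^sup>2)\<^sup>2 \<le> (1 - \<beta>\<^sup>2) * 1"
      unfolding power2_eq_square[of "1 - \<beta>\<^sup>2"] using b2 assms by (intro mult_left_mono) auto
    ultimately show "(1 - \<beta>\<^sup>2)\<^sup>2 \<le> (p * q)\<^sup>2" by simp
  qed (use pq in auto)
  then have "1 - \<alpha> / 4 \<le> ((p + q) / 2)\<^sup>2"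
    using pq b2 by (simp add: power2_eq_square algebra_simps)
  then have "(1 + \<alpha>) * (1 - \<alpha> / 4) \<le> (1 + \<alpha>) * ((p + q) / 2)\<^sup>2"
    using assms by (intro mult_left_mono) auto
  also have "\<dots> = (sqrt (1 + \<alpha>) * (p + q) / 2)\<^sup>2" 
    using assms by (simp add: power_mult_distrib power_divide)
  finally have "(1 + \<alpha>) * (1 - \<alpha> / 4) \<le> (sqrt (1 + \<alpha>) * (p + q) / 2)\<^sup>2" .
  moreover have "(1 + \<alpha> / 10)\<^sup>2 \<le> (1 + \<alpha>) * (1 - \<alpha> / 4)"
    using a2 assms by (simp add: power2_eq_square algebra_simps add_divide_distrib)
  ultimately have "(1 + \<alpha> / 10)\<^sup>2 \<le> (sqrt (1 + \<alpha>) * (p + q) / 2)\<^sup>2"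
    by (rule order_trans[rotated])
  then have "1 + \<alpha> / 10 \<le> sqrt (1 + \<alpha>) * (p + q) / 2"
    by (rule power2_le_imp_le) (use assms pq in auto)
  then show ?thesis unfolding p_def q_def real_sqrt_mult by (simp add: distrib_left add_divide_distrib)
qed

text \<open>Here u and v are the factors by which the geometric mean changes for the pairs (A0, B0)
  and (A0, B1), K0 and K1 are their doublings, and \<open>sum\<close> encodes disjointness of the
  two sumsets. For \<beta> at most 1/2 both factors are bounded below and the pairs can be compared
  symmetrically. For larger \<beta> the factor v may be tiny. At \<beta> = 1 the half B1 is empty, u
  = 1 and v = 0.\<close>

lemma cut_numeric:
  fixes \<alpha> \<beta> K K0 K1 :: real
  defines "u \<equiv> sqrt ((1 + \<alpha>) * (1 + \<beta>)) / 2" and "v \<equiv> sqrt ((1 + \<alpha>) * (1 - \<beta>)) / 2"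
  assumes ab: "0 \<le> \<beta>" "\<beta> \<le> \<alpha>" "\<alpha> \<le> 1" and "K \<ge> 1" and large: "1 / (2 * K) \<le> \<alpha> * \<beta>"
    and K0: "K0 \<ge> 1" and K1: "\<beta> < 1 \<Longrightarrow> K1 \<ge> 1" and sum: "u * K0 + v * K1 \<le> K"
  shows "exp (- 100 * sqrt K) \<le> u * exp (- 100 * sqrt K0) \<or>
    \<beta> < 1 \<and> exp (- 100 * sqrt K) \<le> v * exp (- 100 * sqrt K1)"
proof -
  define k where "k = sqrt K"
  have k: "k \<ge> 1" "K = k\<^sup>2" using \<open>K \<ge> 1\<close> by (auto simp: k_def)
  have a0: "\<alpha> \<ge> 0" using ab by simp
  have u_ge: "(1 + \<beta>) / 2 \<le> u"
  proof -
    have "sqrt ((1 + \<beta>)\<^sup>2) \<le> sqrt ((1 + \<alpha>) * (1 + \<beta>))"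
      using ab by (intro real_sqrt_le_mono) (simp add: power2_eq_square mult_right_mono)
    then show ?thesis using ab by (simp add: u_def)
  qed
  consider "\<beta> \<le> 1 / 2" | "\<beta> > 1 / 2" "\<beta> < 1" | "\<beta> = 1" using ab by linarith
  then show ?thesis
  proof cases
    case 1
    \<comment> \<open>A drop of 1/50 in the square root of the doubling pays for losing a factor 4,
      since exp(-2) is at most 1/4; both u and v are at least 1/4.\<close>
    have e: "exp (- 100 * (1 / 50)) \<le> (1 / 4 :: real)"
    proof -
      have "(2 :: real) \<le> exp 1" using exp_ge_add_one_self[of 1] by simp
      then have "2 * 2 \<le> exp 1 * exp (1 :: real)" by (intro mult_mono) auto
      then have "4 \<le> exp (2 :: real)" by (simp add: exp_add[symmetric])
      then show ?thesis by (simp add: exp_minus field_simps)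
    qed
    have u4: "1 / 4 \<le> u" using u_ge ab by simp
    have v4: "1 / 4 \<le> v"
    proof -
      have "1 * (1 / 2) \<le> (1 + \<alpha>) * (1 - \<beta>)" using 1 a0 by (intro mult_mono) auto
      then have "sqrt (1 / 4) \<le> sqrt ((1 + \<alpha>) * (1 - \<beta>))" by (intro real_sqrt_le_mono) simp
      then show ?thesis by (simp add: v_def real_sqrt_divide)
    qed
    have drop: "k\<^sup>2 - k / 25 < L" if "k - 1 / 50 < sqrt L" "L \<ge> 1" for L
    proof -
      have "(k - 1 / 50)\<^sup>2 < (sqrt L)\<^sup>2" using that k by (intro power_strict_mono) auto
      then show ?thesis using that by (simp add: power2_eq_square algebra_simps)
    qed
    show ?thesis
    proof (rule ccontr)
      \<comment> \<open>If both pairs fail, both doublings exceed k^2 - k/25, and \<open>sum\<close>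
        then contradicts u + v exceeding 1 by a multiple of 1/k.\<close>
      assume neg: "\<not> ?thesis"
      have "k - 1 / 50 < sqrt K0"
        using exp_cut[of "sqrt K0" k "1 / 50" u] e u4 neg by (fastforce simp: k_def)
      then have 2: "k\<^sup>2 - k / 25 < K0" using K0 by (intro drop)
      have "k - 1 / 50 < sqrt K1"
        using exp_cut[of "sqrt K1" k "1 / 50" v] e v4 neg 1 by (fastforce simp: k_def)
      then have 3: "k\<^sup>2 - k / 25 < K1" using K1 1 by (intro drop) auto
      have "(u + v) * (k\<^sup>2 - k / 25) < k\<^sup>2"
      proof -
        have "u * (k\<^sup>2 - k / 25) < u * K0" "v * (k\<^sup>2 - k / 25) < v * K1"
          using 2 3 u4 v4 by (auto intro!: mult_strict_left_mono)
        then have "(u + v) * (k\<^sup>2 - k / 25) < u * K0 + v * K1" by (simp add: distrib_right)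
        then show ?thesis using sum k by simp
      qed
      then have "k * ((u + v) * (k - 1 / 25)) < k * k" by (simp add: power2_eq_square algebra_simps)
      then have 4: "(u + v) * (k - 1 / 25) < k" using k by simp
      \<comment> \<open>7/10 is a rational value just below 1/sqrt 2, and \<alpha>^2 is at least
        \<alpha>\<beta>.\<close>
      have "(7 / 10 / k)\<^sup>2 \<le> 1 / (2 * K)"
        using k by (simp add: power_divide field_simps)
      also have "\<dots> \<le> \<alpha>\<^sup>2"
        using large mult_left_mono[OF ab(2) a0] by (simp add: power2_eq_square)
      finally have "7 / 10 / k \<le> \<alpha>" using a0 by (rule power2_le_imp_le)
      then have "1 + 7 / 100 / k \<le> u + v" using cut_gain[OF ab 1] by (simp add: u_def v_def)
      then have "(1 + 7 / 100 / k) * (k - 1 / 25) \<le> (u + v) * (k - 1 / 25)"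
        using k by (intro mult_right_mono) auto
      \<comment> \<open>The gain 7/100 beats the loss 1/25, with room for the cross term 7/(2500 k)
        because k is at least 1.\<close>
      moreover have "k < (1 + 7 / 100 / k) * (k - 1 / 25)"
        using k by (simp add: field_simps)
      ultimately show False using 4 by simp
    qed
  next
    case 2
    define b where "b = 1 - \<beta>"
    \<comment> \<open>With the fourth root, v is of order at least q^2 and the later bound on
      \<open>sqrt K1\<close> is linear in q.\<close>
    define q where "q = sqrt (sqrt b)"
    have b: "0 < b" "b \<le> 1 / 2" using 2 by (auto simp: b_def)
    have q: "0 < q" "q\<^sup>2 = sqrt b" "q ^ 4 = b"
    proof -
      show q2: "q\<^sup>2 = sqrt b" using b by (simp add: q_def)
      have "q ^ 4 = (q\<^sup>2)\<^sup>2" by simp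
      then show "q ^ 4 = b" using b by (simp only: q2) simp
    qed (use b in \<open>simp add: q_def\<close>)
    have u: "1 - b / 2 \<le> u" using u_ge by (simp add: b_def field_simps)
    have v: "6 / 10 * q\<^sup>2 \<le> v"
    proof -
      have "(144 / 100) * b \<le> (1 + \<alpha>) * b" using 2 ab b by (intro mult_right_mono) auto
      then have "sqrt ((12 / 10)\<^sup>2 * b) \<le> sqrt ((1 + \<alpha>) * (1 - \<beta>))"
        by (intro real_sqrt_le_mono) (simp add: b_def power2_eq_square)
      then show ?thesis unfolding q(2) by (simp add: v_def real_sqrt_mult)
    qed
    show ?thesis
    \<comment> \<open>If K0 drops by this proportion, the larger halves win: the loss in u is at
      most b/2, while the gain exp(-5b) is below 1 - b/2. Otherwise A0 + B0 uses nearly all of A + B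
      and leaves little for A0 + B1.\<close>
    proof (cases "K0 \<le> K * (1 - b / 10)")
      case True
      have "sqrt K0 \<le> k * (1 - b / 20)"
      proof (rule real_le_lsqrt)
        have "K * (1 - b / 10) \<le> K * (1 - b / 20)\<^sup>2"
          using \<open>K \<ge> 1\<close> by (intro mult_left_mono) (auto simp: power2_eq_square algebra_simps)
        then show "K0 \<le> (k * (1 - b / 20))\<^sup>2" using True by (simp add: k power_mult_distrib)
      qed (use k b in auto)
      also have "\<dots> \<le> k - b / 20" using mult_right_mono[OF k(1), of "b / 20"] b
        by (simp add: algebra_simps)
      finally have 3: "sqrt K0 \<le> k - b / 20" .
      have "exp (- 100 * (b / 20)) = 1 / exp (5 * b)" by (simp add: exp_minus field_simps)
      also have "\<dots> \<le> 1 / (1 + 5 * b)"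
        using b exp_ge_add_one_self[of "5 * b"] by (intro divide_left_mono) auto
      also have "\<dots> \<le> 1 - b / 2"
        using b mult_right_mono[of b "1 / 2" b] by (simp add: field_simps)
      finally have "exp (- 100 * (b / 20)) \<le> u" using u by simp
      from exp_cut[OF 3 this] show ?thesis by (simp add: k_def)
    next
      case False
      have "K * (1 - 6 / 10 * b) \<le> K * ((1 - b / 10) * (1 - b / 2))"
        using \<open>K \<ge> 1\<close> by (intro mult_left_mono) (auto simp: algebra_simps)
      also have "\<dots> = (1 - b / 2) * (K * (1 - b / 10))" by simp
      also have "\<dots> \<le> u * K0" using False u b K0 \<open>K \<ge> 1\<close> by (intro mult_mono) auto
      finally have "v * K1 \<le> 6 / 10 * b * K" using sum by (simp add: algebra_simps)
      moreover have "6 / 10 * q\<^sup>2 * K1 \<le> v * K1" using v K1 2 by (intro mult_right_mono) auto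
      ultimately have "q\<^sup>2 * K1 \<le> q\<^sup>2 * (q\<^sup>2 * K)"
        by (simp add: q(3)[symmetric] power2_eq_square power4_eq_xxxx)
      then have "K1 \<le> q\<^sup>2 * K" using q(1) by (rule mult_left_le_imp_le[OF _ zero_less_power])
      then have "K1 \<le> (q * k)\<^sup>2" by (simp add: power_mult_distrib k)
      then have 3: "sqrt K1 \<le> q * k" using q k by (intro real_le_lsqrt) auto
      have "1 \<le> sqrt K1" using K1 2 by simp
      then have 4: "1 \<le> q * k" using 3 by linarith
      \<comment> \<open>The trivial bound that K1 is at least 1 forces k to be large when q is
        small, so the drop k - q k is at least 1/q - 1.\<close>
      then have qk: "1 / q \<le> k" using q by (simp add: field_simps)
      have b1: "q ^ 4 < 1" using b q by simp
      have q1: "q < 1" using b1 q by (metis not_less one_le_power)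
      \<comment> \<open>Since exp(1/q - 1) is at least 1/q, the exponential gain is at most q^8. As
        q^4 = b is at most 1/2, this lies below q^2/2 and hence below v.\<close>
      have "exp (- 100 * (k - q * k)) \<le> exp (- 8 * (1 / q - 1))"
      proof -
        have "1 / q - 1 = (1 - q) * (1 / q)" using q by (simp add: field_simps)
        also have "\<dots> \<le> (1 - q) * k" using qk q1 by (intro mult_left_mono) auto
        finally have "1 / q - 1 \<le> k - q * k" by (simp add: algebra_simps)
        moreover have "0 \<le> k - q * k" using q1 k by simp
        ultimately have "8 * (1 / q - 1) \<le> 100 * (k - q * k)" by argo
        then show ?thesis by simp
      qed
      also have "\<dots> = exp (- (1 / q - 1)) ^ 8" by (simp add: exp_of_nat_mult[symmetric])
      also have "\<dots> \<le> q ^ 8"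
      proof (intro power_mono)
        have "exp (- (1 / q - 1)) = 1 / exp (1 / q - 1)" unfolding exp_minus by (simp add: inverse_eq_divide)
        also have "\<dots> \<le> 1 / (1 / q)"
          using exp_ge_add_one_self[of "1 / q - 1"] q by (intro divide_left_mono) auto
        finally show "exp (- (1 / q - 1)) \<le> q" by simp
      qed simp
      also have "\<dots> = q ^ 4 * q\<^sup>2 * q\<^sup>2" by (simp add: power_add[symmetric])
      also have "\<dots> \<le> 1 / 2 * q\<^sup>2 * 1"
        using b q q1 by (intro mult_mono) (auto intro!: power_le_one)
      also have "\<dots> \<le> v" using v zero_le_power2[of q] by linarith
      finally have "exp (- 100 * (k - q * k)) \<le> v" .
      moreover have "sqrt K1 \<le> k - (k - q * k)" using 3 by simp
      ultimately show ?thesis using exp_cut[of "sqrt K1" k "k - q * k" v] 2 by (simp add: k_def)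
    qed
  next
    case 3
    then have "\<alpha> = 1" using ab by simp
    then have "u = 1" "v = 0" using 3 by (auto simp: u_def v_def)
    then show ?thesis using sum by simp
  qed
qed

section \<open>Doubling and potential of a pair of sets\<close>

definition gmean :: "(nat \<Rightarrow> bit) set \<Rightarrow> (nat \<Rightarrow> bit) set \<Rightarrow> real" where
  "gmean A B = sqrt (real (card A)) * sqrt (real (card B))"

text \<open>For finite nonempty sets this is the least constant K admissible in the hypothesis on A
  + B. If one set is empty, division by zero gives 0.\<close>

definition doubling :: "(nat \<Rightarrow> bit) set \<Rightarrow> (nat \<Rightarrow> bit) set \<Rightarrow> real" where
  "doubling A B = real (card (A + B)) / gmean A B"

definition potential :: "(nat \<Rightarrow> bit) set \<Rightarrow> (nat \<Rightarrow> bit) set \<Rightarrow> real" where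
  "potential A B = gmean A B * exp (- 100 * sqrt (doubling A B))"

lemma gmean_commute: "gmean A B = gmean B A"
  by (simp add: gmean_def mult.commute)

lemma doubling_commute: "doubling A B = doubling B A"
  by (simp add: doubling_def gmean_commute add.commute)

lemma potential_commute: "potential A B = potential B A"
  by (simp add: potential_def gmean_commute doubling_commute)

lemma gmean_pos: "finite A \<Longrightarrow> finite B \<Longrightarrow> A \<noteq> {} \<Longrightarrow> B \<noteq> {} \<Longrightarrow> gmean A B > 0"
  by (simp add: gmean_def card_gt_0_iff)

lemma gmean_mono: "finite A \<Longrightarrow> finite B \<Longrightarrow> A' \<subseteq> A \<Longrightarrow> B' \<subseteq> B \<Longrightarrow> gmean A' B' \<le> gmean A B"
  unfolding gmean_def by (intro mult_mono) (auto intro: card_mono)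

lemma gmean_le:
  assumes "real (card A) \<le> m" "real (card B) \<le> m"
  shows "gmean A B \<le> m"
proof -
  have "m \<ge> 0" using assms(1) of_nat_0_le_iff order_trans by blast
  have "gmean A B \<le> sqrt m * sqrt m"
    unfolding gmean_def using assms \<open>m \<ge> 0\<close> by (intro mult_mono) auto
  then show ?thesis using \<open>m \<ge> 0\<close> by simp
qed

lemma card_le_card_sumset:
  fixes A B :: "(nat \<Rightarrow> bit) set"
  assumes "finite A" "finite B" "B \<noteq> {}"
  shows "card A \<le> card (A + B)"
proof -
  obtain b where "b \<in> B" using assms by blast
  then have "(\<lambda>a. a + b) ` A \<subseteq> A + B" by auto
  then have "card ((\<lambda>a. a + b) ` A) \<le> card (A + B)"
    using assms by (intro card_mono finite_set_plus)
  then show ?thesis by (simp add: card_image)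
qed

text \<open>A + B contains translates of both sets, so its size dominates |A| and |B| and hence
  their geometric mean.\<close>

lemma doubling_ge_1:
  assumes "finite A" "finite B" "A \<noteq> {}" "B \<noteq> {}"
  shows "doubling A B \<ge> 1"
  unfolding doubling_def
  using gmean_pos[OF assms] card_le_card_sumset[of A B] card_le_card_sumset[of B A] assms
  by (simp add: gmean_le add.commute[of B A])

section \<open>Existence of a cut that preserves the potential\<close>

text \<open>The sign \<sigma> is the majority value of the character on A, and the absolute
  coefficient is the difference of the two counts. That \<sigma> is nonzero later separates a
  product of signs from its negative.\<close>

lemma card_split_hat:
  assumes "finite A"
  obtains \<sigma> where "real (card {x \<in> A. chi n \<xi> x = \<sigma>}) = (real (card A) + \<bar>hat n A \<xi>\<bar>) / 2"
    "real (card {x \<in> A. chi n \<xi> x = - \<sigma>}) = (real (card A) - \<bar>hat n A \<xi>\<bar>) / 2" "\<sigma> \<noteq> 0"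
proof -
  let ?A = "\<lambda>\<sigma>. {x \<in> A. chi n \<xi> x = \<sigma>}"
  have A: "A = ?A 1 \<union> ?A (- 1)" using chi_cases by blast
  have disj: "?A 1 \<inter> ?A (- 1) = {}" by auto
  have fin: "finite (?A 1)" "finite (?A (- 1))" using assms by auto
  have c: "real (card A) = real (card (?A 1)) + real (card (?A (- 1)))"
    using card_Un_disjoint[OF fin disj] A by simp
  have h: "hat n A \<xi> = real (card (?A 1)) - real (card (?A (- 1)))"
    unfolding hat_def by (subst A, subst sum.union_disjoint[OF fin disj]) simp
  show thesis
    by (cases "hat n A \<xi> \<ge> 0") (rule that[of 1] that[of "- 1"]; use c h in simp)+
qed

text \<open>Only the larger half of A, the set with the larger relative coefficient, is kept,
  against both halves of B. The character is constant on each of the two sumsets with opposite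
  signs, so they are disjoint inside A + B; division by the geometric mean reduces the claim to
  \<open>cut_numeric\<close>.\<close>

lemma hyperplane_cut_aux:
  assumes fin: "finite A" "finite B" and ne: "A \<noteq> {}" "B \<noteq> {}"
    and le: "\<bar>hat n B \<xi>\<bar> / real (card B) \<le> \<bar>hat n A \<xi>\<bar> / real (card A)"
    and large: "real (card A) * real (card B) / (2 * doubling A B) \<le> \<bar>hat n A \<xi> * hat n B \<xi>\<bar>"
  obtains \<sigma> \<tau> where "{x \<in> A. chi n \<xi> x = \<sigma>} \<noteq> {}" "{x \<in> B. chi n \<xi> x = \<tau>} \<noteq> {}"
    "potential A B \<le> potential {x \<in> A. chi n \<xi> x = \<sigma>} {x \<in> B. chi n \<xi> x = \<tau>}"
proof -
  define a b where "a = real (card A)" and "b = real (card B)"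
  define \<alpha> \<beta> where "\<alpha> = \<bar>hat n A \<xi>\<bar> / a" and "\<beta> = \<bar>hat n B \<xi>\<bar> / b"
  have ab0: "a > 0" "b > 0" using fin ne by (auto simp: a_def b_def card_gt_0_iff)
  have ab: "0 \<le> \<beta>" "\<beta> \<le> \<alpha>" "\<alpha> \<le> 1"
    using le ab0 abs_hat_le[of n A \<xi>] by (auto simp: \<alpha>_def \<beta>_def a_def b_def)
  obtain \<sigma> where \<sigma>: "real (card {x \<in> A. chi n \<xi> x = \<sigma>}) = (1 + \<alpha>) / 2 * a" "\<sigma> \<noteq> 0"
    using card_split_hat[OF fin(1), of n \<xi>] ab0 by (auto simp: \<alpha>_def a_def field_simps)
  obtain \<tau> where \<tau>: "real (card {x \<in> B. chi n \<xi> x = \<tau>}) = (1 + \<beta>) / 2 * b"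
    "real (card {x \<in> B. chi n \<xi> x = - \<tau>}) = (1 - \<beta>) / 2 * b" "\<tau> \<noteq> 0"
    using card_split_hat[OF fin(2), of n \<xi>] ab0 by (auto simp: \<beta>_def b_def field_simps)
  define A0 B0 B1 where "A0 = {x \<in> A. chi n \<xi> x = \<sigma>}"
    and "B0 = {x \<in> B. chi n \<xi> x = \<tau>}" and "B1 = {x \<in> B. chi n \<xi> x = - \<tau>}"
  note defs = A0_def B0_def B1_def
  have cards: "real (card A0) = (1 + \<alpha>) / 2 * a" "real (card B0) = (1 + \<beta>) / 2 * b"
    "real (card B1) = (1 - \<beta>) / 2 * b" using \<sigma> \<tau> by (auto simp: defs)
  have fins: "finite A0" "finite B0" "finite B1" using fin by (auto simp: defs)
  have "real (card A0) > 0" "real (card B0) > 0" unfolding cards using ab ab0 by simp_all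
  then have ne0: "A0 \<noteq> {}" "B0 \<noteq> {}" by auto
  have ne1: "B1 \<noteq> {}" if "\<beta> < 1"
  proof -
    have "real (card B1) > 0" unfolding cards using ab0 that by simp
    then show ?thesis by auto
  qed
  define u v where "u = sqrt ((1 + \<alpha>) * (1 + \<beta>)) / 2" and "v = sqrt ((1 + \<alpha>) * (1 - \<beta>)) / 2"
  define s where "s = gmean A B"
  have s: "s = sqrt (a * b)" "s > 0"
    using gmean_pos[OF fin ne] by (auto simp: s_def gmean_def a_def b_def real_sqrt_mult)
  have s0: "gmean A0 B0 = u * s"
    unfolding gmean_def cards s u_def by (simp add: real_sqrt_mult real_sqrt_divide)
  have s1: "gmean A0 B1 = v * s"
    unfolding gmean_def cards s v_def by (simp add: real_sqrt_mult real_sqrt_divide)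
  have T: "card (A0 + B0) + card (A0 + B1) \<le> card (A + B)"
  proof -
    have "(A0 + B0) \<inter> (A0 + B1) = {}"
    proof -
      have "chi n \<xi> z = \<sigma> * \<tau>" if "z \<in> A0 + B0" for z
        using that by (auto simp: defs set_plus_def chi_add)
      moreover have "chi n \<xi> z = - (\<sigma> * \<tau>)" if "z \<in> A0 + B1" for z
        using that by (auto simp: defs set_plus_def chi_add)
      moreover have "\<sigma> * \<tau> \<noteq> - (\<sigma> * \<tau>)" using \<sigma>(2) \<tau>(3) by simp
      ultimately show ?thesis by fastforce
    qed
    then have "card (A0 + B0) + card (A0 + B1) = card ((A0 + B0) \<union> (A0 + B1))"
      using fins by (intro card_Un_disjoint[symmetric] finite_set_plus)
    also have "\<dots> \<le> card (A + B)"
      using fin by (intro card_mono finite_set_plus) (auto simp: defs set_plus_def)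
    finally show ?thesis .
  qed
  define K K0 K1 where "K = doubling A B" and "K0 = doubling A0 B0" and "K1 = doubling A0 B1"
  have K: "K \<ge> 1" "K0 \<ge> 1" "\<beta> < 1 \<Longrightarrow> K1 \<ge> 1"
    using doubling_ge_1 fin ne fins ne0 ne1 by (auto simp: K_def K0_def K1_def)
  \<comment> \<open>This also covers an empty B1, where \<open>gmean\<close> and
    \<open>doubling\<close> are both 0.\<close>
  have dbl: "doubling X Y * gmean X Y \<le> real (card (X + Y))" for X Y
    by (simp add: doubling_def)
  have "s * (u * K0 + v * K1) \<le> s * K"
  proof -
    have "s * (u * K0 + v * K1) \<le> real (card (A0 + B0)) + real (card (A0 + B1))"
      using dbl[of A0 B0] dbl[of A0 B1] unfolding s0 s1 K0_def K1_def by (simp add: algebra_simps)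
    also have "\<dots> \<le> real (card (A + B))" using T by linarith
    also have "\<dots> = s * K" using s(2) by (simp add: K_def doubling_def s_def[symmetric])
    finally show ?thesis .
  qed
  then have sum: "u * K0 + v * K1 \<le> K" using s by simp
  have "1 / (2 * K) \<le> \<alpha> * \<beta>"
    using large ab0 K unfolding K_def[symmetric] a_def[symmetric] b_def[symmetric]
    by (simp add: \<alpha>_def \<beta>_def abs_mult field_simps)
  from cut_numeric[OF ab K(1) this K(2) K(3) sum[unfolded u_def v_def]]
  consider "exp (- 100 * sqrt K) \<le> u * exp (- 100 * sqrt K0)"
    | "\<beta> < 1" "exp (- 100 * sqrt K) \<le> v * exp (- 100 * sqrt K1)"
    by (auto simp: u_def v_def)
  then show thesis
  proof cases
    case 1
    then have "s * exp (- 100 * sqrt K) \<le> s * (u * exp (- 100 * sqrt K0))"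
      using s by (intro mult_left_mono) auto
    then have "potential A B \<le> potential A0 B0"
      by (simp add: potential_def s0 s_def[symmetric] K_def K0_def mult_ac)
    then show thesis using that[of \<sigma> \<tau>] ne0 by (simp add: defs)
  next
    case 2
    then have "s * exp (- 100 * sqrt K) \<le> s * (v * exp (- 100 * sqrt K1))"
      using s by (intro mult_left_mono) auto
    then have "potential A B \<le> potential A0 B1"
      by (simp add: potential_def s1 s_def[symmetric] K_def K1_def mult_ac)
    then show thesis using that[of \<sigma> "- \<tau>"] ne0 ne1[OF 2(1)] by (simp add: defs)
  qed
qed

text \<open>All quantities are symmetric in A and B, so the ordering of the relative coefficients
  may be assumed.\<close>

lemma hyperplane_cut:
  assumes fin: "finite A" "finite B" and ne: "A \<noteq> {}" "B \<noteq> {}"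
    and large: "real (card A) * real (card B) / (2 * doubling A B) \<le> \<bar>hat n A \<xi> * hat n B \<xi>\<bar>"
  obtains \<sigma> \<tau> where "{x \<in> A. chi n \<xi> x = \<sigma>} \<noteq> {}" "{x \<in> B. chi n \<xi> x = \<tau>} \<noteq> {}"
    "potential A B \<le> potential {x \<in> A. chi n \<xi> x = \<sigma>} {x \<in> B. chi n \<xi> x = \<tau>}"
proof (cases "\<bar>hat n B \<xi>\<bar> / real (card B) \<le> \<bar>hat n A \<xi>\<bar> / real (card A)")
  case True
  show thesis by (rule hyperplane_cut_aux[OF fin ne True large that])
next
  case False
  then have le: "\<bar>hat n A \<xi>\<bar> / real (card A) \<le> \<bar>hat n B \<xi>\<bar> / real (card B)" by simp
  have large': "real (card B) * real (card A) / (2 * doubling B A) \<le> \<bar>hat n B \<xi> * hat n A \<xi>\<bar>"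
    using large by (simp add: doubling_commute[of B A] mult.commute)
  show thesis
    by (rule hyperplane_cut_aux[OF fin(2,1) ne(2,1) le large'])
      (rule that; simp add: potential_commute)
qed

text \<open>The geometric mean can only shrink on subsets, so the potential is kept only if the
  exponential factor does not decrease. The density bound thus never worsens during the
  iteration.\<close>

lemma potential_le_imp_doubling_le:
  assumes "finite A" "finite B" "A' \<subseteq> A" "B' \<subseteq> B" "A' \<noteq> {}" "B' \<noteq> {}"
    and "potential A B \<le> potential A' B'"
  shows "doubling A' B' \<le> doubling A B"
proof -
  have "gmean A' B' > 0" using assms finite_subset by (intro gmean_pos) auto
  moreover have "gmean A' B' \<le> gmean A B" using assms by (intro gmean_mono)
  moreover have "gmean A' B' * exp (- 100 * sqrt (doubling A B)) \<le> potential A B"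
    unfolding potential_def using \<open>gmean A' B' \<le> gmean A B\<close> by (intro mult_right_mono) auto
  ultimately have "gmean A' B' * exp (- 100 * sqrt (doubling A B))
      \<le> gmean A' B' * exp (- 100 * sqrt (doubling A' B'))"
    using assms(7) unfolding potential_def[of A' B'] by linarith
  then have "exp (- 100 * sqrt (doubling A B)) \<le> exp (- 100 * sqrt (doubling A' B'))"
    using \<open>gmean A' B' > 0\<close> by (rule mult_left_le_imp_le)
  then show ?thesis by simp
qed

section \<open>Iteration\<close>

text \<open>Induction on |H|, with A and B each inside a coset of H. In the flat case H itself
  works. Otherwise the cut pieces lie in cosets of the kernel of \<xi> on H, which is strictly
  smaller because \<xi> does not annihilate H.\<close>

lemma dense_subspace:
  assumes "F2.subspace H" "H \<subseteq> F2_space n" "A \<subseteq> F2_space n" "B \<subseteq> F2_space n" "A \<noteq> {}" "B \<noteq> {}"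
    "x \<in> F2_space n" "y \<in> F2_space n" "A \<subseteq> x +o H" "B \<subseteq> y +o H"
  shows "\<exists>H'. F2.subspace H' \<and> H' \<subseteq> F2_space n \<and> potential A B \<le> real (card H') \<and>
    (\<exists>x\<in>F2_space n. \<exists>y\<in>F2_space n.
      1 / (2 * doubling A B) * real (card H') \<le> gmean (A \<inter> (x +o H')) (B \<inter> (y +o H')))"
  using assms
proof (induction "card H" arbitrary: H A B x y rule: less_induct)
  case less
  note H = less.prems(1,2) and AB = less.prems(3-6) and xy = less.prems(7,8)
    and cos = less.prems(9,10)
  have fin: "finite A" "finite B" "finite H"
    using AB H(2) finite_F2_space finite_subset by blast+
  have D: "doubling A B \<ge> 1" using fin AB by (intro doubling_ge_1)
  have sumset: "real (card (A + B)) \<le> doubling A B * sqrt (real (card A)) * sqrt (real (card B))"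
    using gmean_pos[OF fin(1,2) AB(3,4)] by (simp add: doubling_def mult.assoc gmean_def[symmetric])
  show ?case
  proof (cases "\<forall>\<xi>\<in>F2_space n. \<xi> \<notin> annihilator n H \<longrightarrow>
      \<bar>hat n A \<xi> * hat n B \<xi>\<bar> \<le> real (card A) * real (card B) / (2 * doubling A B)")
    case True
    have "1 / (2 * doubling A B) * real (card H) \<le> gmean A B"
      unfolding gmean_def using D True by (intro flat_dense[OF H AB _ sumset]) auto
    moreover have "A \<inter> (x +o H) = A" "B \<inter> (y +o H) = B" using cos by auto
    \<comment> \<open>The coset containments bound the geometric mean by |H|, which turns the
      preserved potential into the lower bound on the final subspace.\<close>
    moreover have "potential A B \<le> real (card H)"
    proof -
      have "card (z +o H) = card H" for z
        proof -
        have "z +o H = (+) z ` H" by (auto simp: elt_set_plus_def)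
        then show ?thesis by (simp add: card_image)
      qed
      moreover have "finite (z +o H)" for z
        using fin by (simp add: elt_set_plus_def Setcompr_eq_image)
      ultimately have "card A \<le> card H" "card B \<le> card H" using cos card_mono by metis+
      then have "gmean A B \<le> real (card H)" by (intro gmean_le) auto
      moreover have "potential A B \<le> gmean A B * 1"
        unfolding potential_def using D by (intro mult_left_mono) (auto simp: gmean_def)
      ultimately show ?thesis by simp
    qed
    ultimately show ?thesis using H xy by metis
  next
    case False
    then obtain \<xi> where \<xi>: "\<xi> \<in> F2_space n" "\<xi> \<notin> annihilator n H"
      "real (card A) * real (card B) / (2 * doubling A B) \<le> \<bar>hat n A \<xi> * hat n B \<xi>\<bar>"
      by force
    obtain \<sigma> \<tau> where cut: "{x \<in> A. chi n \<xi> x = \<sigma>} \<noteq> {}" "{x \<in> B. chi n \<xi> x = \<tau>} \<noteq> {}"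
      "potential A B \<le> potential {x \<in> A. chi n \<xi> x = \<sigma>} {x \<in> B. chi n \<xi> x = \<tau>}"
      using hyperplane_cut[OF fin(1,2) AB(3,4) \<xi>(3)] .
    define A' B' H' where "A' = {x \<in> A. chi n \<xi> x = \<sigma>}" and "B' = {x \<in> B. chi n \<xi> x = \<tau>}"
      and "H' = {h \<in> H. chi n \<xi> h = 1}"
    note cut = cut[folded A'_def B'_def]
    have sub: "A' \<subseteq> A" "B' \<subseteq> B" by (auto simp: A'_def B'_def)
    have "H' \<subset> H" using \<xi>(1,2) by (auto simp: H'_def annihilator_def)
    then have card: "card H' < card H" using fin by (intro psubset_card_mono)
    have H': "F2.subspace H'" "H' \<subseteq> F2_space n"
    proof -
      have "F2_scale c h \<in> H'" if "h \<in> H'" for c h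
        using that H(1) F2.subspace_scale[OF H(1)] F2.subspace_0[OF H(1)]
        by (cases c) (auto simp: H'_def)
      then show "F2.subspace H'"
        using F2.subspace_0[OF H(1)] F2.subspace_add[OF H(1)]
        by (auto simp: F2.subspace_def H'_def chi_add)
    qed (use H in \<open>auto simp: H'_def\<close>)
    \<comment> \<open>Any point x' of the piece serves as base point: in characteristic 2 the sum x'
      + w is a difference, so it lies in H, and equal character values put it in the kernel.\<close>
    have coset: "X' \<subseteq> x' +o H'"
      if c: "X \<subseteq> z +o H" "X' = {x \<in> X. chi n \<xi> x = \<rho>}" "x' \<in> X'" for X X' z \<rho> x'
    proof
      fix w assume w: "w \<in> X'"
      obtain h1 where h1: "h1 \<in> H" "w = z + h1"
        using w c unfolding elt_set_plus_def by blast
      obtain h2 where h2: "h2 \<in> H" "x' = z + h2"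
        using c unfolding elt_set_plus_def by blast
      have "x' + w = h2 + h1"
        unfolding h1 h2 by (metis F2_add_self_left add.assoc add.commute)
      then have "x' + w \<in> H" using h1 h2 F2.subspace_add[OF H(1)] by simp
      moreover have "chi n \<xi> (x' + w) = chi n \<xi> x' * chi n \<xi> x'" using w c by (simp add: chi_add)
      ultimately have "x' + w \<in> H'" by (simp add: H'_def)
      then have "x' + (x' + w) \<in> x' +o H'" by (rule set_plus_intro2)
      then show "w \<in> x' +o H'" by simp
    qed
    obtain x' y' where x': "x' \<in> A'" "y' \<in> B'" using cut by auto
    have "A' \<subseteq> x' +o H'" "B' \<subseteq> y' +o H'"
      using coset[OF cos(1) A'_def x'(1)] coset[OF cos(2) B'_def x'(2)] by auto
    then obtain H'' x'' y'' where IH: "F2.subspace H''" "H'' \<subseteq> F2_space n"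
      "potential A' B' \<le> real (card H'')" "x'' \<in> F2_space n" "y'' \<in> F2_space n"
      "1 / (2 * doubling A' B') * real (card H'') \<le> gmean (A' \<inter> (x'' +o H'')) (B' \<inter> (y'' +o H''))"
      using less.hyps[OF card H' _ _ cut(1,2), of x' y'] sub AB x' by blast
    have "doubling A' B' \<le> doubling A B"
      using potential_le_imp_doubling_le[OF fin(1,2) sub cut] .
    moreover have "doubling A' B' \<ge> 1"
      using fin cut sub finite_subset by (intro doubling_ge_1) auto
    ultimately have "1 / (2 * doubling A B) * real (card H'')
        \<le> 1 / (2 * doubling A' B') * real (card H'')"
      by (intro mult_right_mono divide_left_mono) auto
    also note IH(6)
    also have "gmean (A' \<inter> (x'' +o H'')) (B' \<inter> (y'' +o H''))
        \<le> gmean (A \<inter> (x'' +o H'')) (B \<inter> (y'' +o H''))"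
      using sub fin by (intro gmean_mono) auto
    finally show ?thesis using IH cut(3) by (meson order_trans)
  qed
qed

theorem theorem4:
  "\<exists>c C :: real. c > 0 \<and> C > 0 \<and>
    (\<forall>(n::nat) (K::real) (A :: (nat \<Rightarrow> bit) set) (B :: (nat \<Rightarrow> bit) set).
      n \<ge> 1 \<longrightarrow> K \<ge> 1 \<longrightarrow>
      A \<subseteq> F2_space n \<longrightarrow> B \<subseteq> F2_space n \<longrightarrow> A \<noteq> {} \<longrightarrow> B \<noteq> {} \<longrightarrow>
      real (card (A + B)) \<le> K * sqrt (real (card A)) * sqrt (real (card B)) \<longrightarrow>
      (\<exists>H. F2.subspace H \<and> H \<subseteq> F2_space n \<and>
        real (card H) \<ge> c * exp (- C * sqrt K) * real (card A) \<and>
        (\<exists>x \<in> F2_space n. \<exists>y \<in> F2_space n.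
          sqrt (real (card (A \<inter> (x +o H)))) * sqrt (real (card (B \<inter> (y +o H))))
            \<ge> 1 / (2 * K) * real (card H))))"
\<comment> \<open>The exponent 102 is 100 from the potential plus 2 for passing from the geometric
  mean to |A|.\<close>
proof (rule exI[of _ 1], rule exI[of _ 102], intro conjI allI impI)
  fix n K A B
  assume K: "(K :: real) \<ge> 1" and AB: "A \<subseteq> F2_space n" "B \<subseteq> F2_space n" "A \<noteq> {}" "B \<noteq> {}"
    and small: "real (card (A + B)) \<le> K * sqrt (real (card A)) * sqrt (real (card B))"
  have fin: "finite A" "finite B" using AB finite_F2_space finite_subset by blast+
  have g: "gmean A B > 0" using fin AB by (intro gmean_pos)
  have D: "doubling A B \<le> K" "doubling A B \<ge> 1"
    using small g doubling_ge_1[OF fin AB(3,4)]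
    by (auto simp: doubling_def gmean_def divide_le_eq mult.assoc)
  \<comment> \<open>The iteration starts with the whole space as the coset of itself at 0.\<close>
  have "0 +o F2_space n = F2_space n" "0 \<in> F2_space n" by (auto simp: F2_space_def)
  then obtain H x y where H: "F2.subspace H" "H \<subseteq> F2_space n" "potential A B \<le> real (card H)"
    "x \<in> F2_space n" "y \<in> F2_space n"
    "1 / (2 * doubling A B) * real (card H) \<le> gmean (A \<inter> (x +o H)) (B \<inter> (y +o H))"
    using dense_subspace[OF subspace_F2_space order_refl AB, of 0 0] AB by auto
  have "1 / (2 * K) * real (card H) \<le> 1 / (2 * doubling A B) * real (card H)"
    using D by (intro mult_right_mono divide_left_mono) auto
  with H have 1: "1 / (2 * K) * real (card H)
      \<le> sqrt (real (card (A \<inter> (x +o H)))) * sqrt (real (card (B \<inter> (y +o H))))"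
    by (simp add: gmean_def)
  \<comment> \<open>Since |A| is at most |A+B|, hence at most K times the geometric mean, the two
    sizes differ by a factor that the exponential absorbs.\<close>
  have "K \<le> exp (2 * sqrt K)"
  proof -
    have "sqrt K \<le> exp (sqrt K)" using exp_ge_add_one_self[of "sqrt K"] by linarith
    then have "sqrt K * sqrt K \<le> exp (sqrt K) * exp (sqrt K)"
      using K by (intro mult_mono) auto
    then show ?thesis using K by (simp add: exp_add[symmetric])
  qed
  moreover have "real (card A) \<le> K * gmean A B"
    using small card_le_card_sumset[OF fin AB(4)] by (simp add: gmean_def mult.assoc)
  ultimately have "real (card A) \<le> exp (2 * sqrt K) * gmean A B"
    using g by (meson mult_right_mono less_imp_le order_trans)
  then have "exp (- 102 * sqrt K) * real (card A)
      \<le> exp (- 102 * sqrt K) * (exp (2 * sqrt K) * gmean A B)"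
    by (intro mult_left_mono) auto
  also have "\<dots> = gmean A B * exp (- 100 * sqrt K)"
    by (simp add: mult.assoc[symmetric] exp_add[symmetric])
  also have "\<dots> \<le> potential A B"
    unfolding potential_def using D g by (intro mult_left_mono) auto
  finally have "real (card H) \<ge> 1 * exp (- 102 * sqrt K) * real (card A)"
    using H(3) by simp
  with H 1 show "\<exists>H. F2.subspace H \<and> H \<subseteq> F2_space n \<and>
      real (card H) \<ge> 1 * exp (- 102 * sqrt K) * real (card A) \<and>
      (\<exists>x \<in> F2_space n. \<exists>y \<in> F2_space n.
        sqrt (real (card (A \<inter> (x +o H)))) * sqrt (real (card (B \<inter> (y +o H))))
          \<ge> 1 / (2 * K) * real (card H))"
    by blast
qed simp_all

end
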